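(* Let $G$ be a connected $d$-regular bipartite graph with $n$ vertices. Then its cyclomatic number $c$ satisfies $$c=\frac{n}{2}(d-2)+1.$$
   Context: Graphs are finite, simple and undirected. The cyclomatic number $c$ of a connected graph is the number of independent cycles, equivalently the minimum number of edges to be removed to get a tree; thus a connected graph with $n$ vertices and $m$ edges satisfies $m=n-1+c$. *)

theory Defs
  imports Complex_Main "Graph_Theory.Graph_Theory"
begin

text \<open>
  As in Graph_Theory, a finite simple undirected graph is a \<^const>\<open>pair_graph\<close>: a finite
  loop-free digraph whose arc relation is symmetric. Each undirected edge is thus represented by
  two opposite arcs, the degree of a vertex is its \<^const>\<open>out_degree\<close>, and undirected edges are
  counted via the two-element sets below.
\<close>

definition uedges :: "'a pair_pre_digraph \<Rightarrow> 'a set set" where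
  "uedges G = (\<lambda>(u, v). {u, v}) ` parcs G"

definition del_uedges :: "'a pair_pre_digraph \<Rightarrow> 'a set set \<Rightarrow> 'a pair_pre_digraph" where
  "del_uedges G F = \<lparr>pverts = pverts G, parcs = {(u, v) \<in> parcs G. {u, v} \<notin> F}\<rparr>"

text \<open>
  In a symmetric digraph the closed walk a, b, a is a \<^const>\<open>pre_digraph.cycle\<close>, so
  \<^const>\<open>forest\<close> and \<^const>\<open>tree\<close> from Graph_Theory are not the undirected notions.
  The cycles of the undirected graph are exactly the directed cycles of length at least 3.
\<close>

definition undirected_cycle :: "'a pair_pre_digraph \<Rightarrow> ('a \<times> 'a) awalk \<Rightarrow> bool" where
  "undirected_cycle G p \<longleftrightarrow> pre_digraph.cycle (with_proj G) p \<and> 3 \<le> length p"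

definition undirected_tree :: "'a pair_pre_digraph \<Rightarrow> bool" where
  "undirected_tree G \<longleftrightarrow>
     pair_graph G \<and> Digraph_Component.connected (with_proj G) \<and> (\<nexists>p. undirected_cycle G p)"

text \<open>
  The minimum number of edges whose removal leaves a tree. Only meaningful for connected graphs,
  since otherwise no such set of edges exists.
\<close>

definition cyclomatic_number :: "'a pair_pre_digraph \<Rightarrow> nat" where
  "cyclomatic_number G =
     (LEAST k. \<exists>F \<subseteq> uedges G. card F = k \<and> undirected_tree (del_uedges G F))"

definition regular_graph :: "nat \<Rightarrow> 'a pair_pre_digraph \<Rightarrow> bool" where
  "regular_graph d G \<longleftrightarrow> (\<forall>v \<in> pverts G. out_degree (with_proj G) v = d)"

definition bipartite_graph :: "'a pair_pre_digraph \<Rightarrow> bool" where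
  "bipartite_graph G \<longleftrightarrow> (\<exists>U V. pverts G = U \<union> V \<and> U \<inter> V = {} \<and>
     (\<forall>(u, v) \<in> parcs G. (u \<in> U \<and> v \<in> V) \<or> (u \<in> V \<and> v \<in> U)))"

end

(* For a connected graph with m edges and n vertices the cyclomatic number is m - (n - 1): in a
   graph all of whose edges are bridges, every edge lowers the number of components by one, so a
   tree has n - 1 edges; and a maximal set of edges whose deletion keeps the graph connected leaves
   only bridges, that is, a tree. In a d-regular graph 2 m = n d. *)

theory Submission
  imports Defs
begin

section \<open>Components and bridges of symmetric relations\<close>

definition components :: "'a set \<Rightarrow> 'a rel \<Rightarrow> 'a set set" where
  "components V E = (\<lambda>v. E\<^sup>* `` {v}) ` V"

text \<open>An undirected edge is a pair of opposite arcs, so both are taken away before testing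
  whether its ends are still joined.\<close>

definition all_bridges :: "'a rel \<Rightarrow> bool" where
  "all_bridges E \<longleftrightarrow> (\<forall>(u, v) \<in> E. (u, v) \<notin> (E - {(u, v), (v, u)})\<^sup>*)"

lemma all_bridges_subset:
  assumes "all_bridges E" "E' \<subseteq> E"
  shows "all_bridges E'"
proof -
  have "(E' - {(u, v), (v, u)})\<^sup>* \<subseteq> (E - {(u, v), (v, u)})\<^sup>*" for u v
    using assms(2) by (intro rtrancl_mono) auto
  then show ?thesis
    using assms unfolding all_bridges_def by blast
qed

text \<open>The classes of \<open>a\<close> and \<open>b\<close> are distinct and merge into their
  union; every other class stays as it is.\<close>

lemma components_insert_bridge:
  assumes "finite V" "sym E" "a \<in> V" "b \<in> V" "(a, b) \<notin> E\<^sup>*"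
  shows "card (components V E) = Suc (card (components V (insert (a, b) (insert (b, a) E))))"
proof -
  let ?C = "\<lambda>v. E\<^sup>* `` {v}"
  let ?E' = "insert (a, b) (insert (b, a) E)"
  have symE: "(x, y) \<in> E\<^sup>* \<Longrightarrow> (y, x) \<in> E\<^sup>*" for x y
    using assms(2) by (meson symE sym_rtrancl)
  have transE: "(x, y) \<in> E\<^sup>* \<Longrightarrow> (y, z) \<in> E\<^sup>* \<Longrightarrow> (x, z) \<in> E\<^sup>*" for x y z
    by (rule rtrancl_trans)
  \<comment> \<open>Applying \<open>rtrancl_insert\<close> once per arc also yields walks that cross
    the new edge there and back; transitivity of \<open>E\<^sup>*\<close> absorbs them.\<close>
  have reach: "(x, y) \<in> ?E'\<^sup>* \<longleftrightarrow> (x, y) \<in> E\<^sup>* \<or> (x, a) \<in> E\<^sup>* \<and> (b, y) \<in> E\<^sup>* \<or>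
      (x, b) \<in> E\<^sup>* \<and> (a, y) \<in> E\<^sup>*" for x y
    unfolding rtrancl_insert using symE transE by blast
  have cls: "?E'\<^sup>* `` {v} = (if v \<in> ?C a \<union> ?C b then ?C a \<union> ?C b else ?C v)" for v
  proof -
    have same: "(v, y) \<in> E\<^sup>* \<longleftrightarrow> (w, y) \<in> E\<^sup>*" if "(w, v) \<in> E\<^sup>*" for w y
      using that symE transE by blast
    consider "(a, v) \<in> E\<^sup>*" | "(b, v) \<in> E\<^sup>*" | "(a, v) \<notin> E\<^sup>*" "(b, v) \<notin> E\<^sup>*"
      by blast
    then show ?thesis
    proof cases
      case 1
      then show ?thesis
        by (intro set_eqI) (auto simp add: reach same[OF 1])
    next
      case 2
      then show ?thesis
        by (intro set_eqI) (auto simp add: reach same[OF 2])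
    next
      case 3
      then have "(v, a) \<notin> E\<^sup>*" "(v, b) \<notin> E\<^sup>*"
        using symE by blast+
      with 3 show ?thesis
        by (intro set_eqI) (simp add: reach)
    qed
  qed
  have cls_eq: "?C v = ?C w" if "(w, v) \<in> E\<^sup>*" for v w
    using that symE transE by blast
  have self: "v \<in> ?C v" for v by simp
  have "?C a \<noteq> ?C b"
    using assms(5) self by blast
  moreover have "?C a \<in> components V E" "?C b \<in> components V E"
    using assms(3,4) by (auto simp: components_def)
  \<comment> \<open>The union must be new among the classes, so that removing two classes and
    inserting it lowers the count by exactly one.\<close>
  moreover have new: "?C a \<union> ?C b \<notin> components V E"
  proof
    assume "?C a \<union> ?C b \<in> components V E"
    then obtain v where "?C a \<union> ?C b = ?C v"
      by (auto simp: components_def)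
    then have "(v, a) \<in> E\<^sup>*" "(v, b) \<in> E\<^sup>*"
      by blast+
    with assms(5) symE transE show False by blast
  qed
  moreover have "components V ?E' = insert (?C a \<union> ?C b) (components V E - {?C a, ?C b})"
  proof (intro equalityI subsetI)
    fix X assume "X \<in> components V ?E'"
    then obtain v where v: "v \<in> V" "X = ?E'\<^sup>* `` {v}"
      by (auto simp: components_def)
    show "X \<in> insert (?C a \<union> ?C b) (components V E - {?C a, ?C b})"
    proof (cases "v \<in> ?C a \<union> ?C b")
      case True
      then show ?thesis using v cls by simp
    next
      case False
      then have "X = ?C v" using v cls by simp
      moreover have "?C v \<noteq> ?C a" "?C v \<noteq> ?C b"
        using False self[of v] by auto
      ultimately show ?thesis using v by (auto simp: components_def)
    qed
  next
    fix X assume X: "X \<in> insert (?C a \<union> ?C b) (components V E - {?C a, ?C b})"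
    show "X \<in> components V ?E'"
    proof (cases "X = ?C a \<union> ?C b")
      case True
      then have "X = ?E'\<^sup>* `` {a}" using cls self by auto
      then show ?thesis using assms(3) by (auto simp: components_def)
    next
      case False
      then obtain v where v: "v \<in> V" "X = ?C v" "?C v \<noteq> ?C a" "?C v \<noteq> ?C b"
        using X by (auto simp: components_def)
      then have "v \<notin> ?C a \<union> ?C b" using cls_eq by blast
      then have "X = ?E'\<^sup>* `` {v}" using v cls by simp
      then show ?thesis using v by (auto simp: components_def)
    qed
  qed
  moreover have fin: "finite (components V E)"
    using assms(1) by (simp add: components_def)
  moreover have "card (components V E) = Suc (Suc (card (components V E - {?C a, ?C b})))"
  proof -
    have "card {?C a, ?C b} \<le> card (components V E)"
      using calculation by (intro card_mono) auto
    then show ?thesis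
      using calculation by (subst card_Diff_subset) auto
  qed
  ultimately show ?thesis
    by simp
qed

text \<open>The left-hand side is invariant under deleting an edge: two arcs disappear and one
  component splits in two. Without arcs every vertex is its own component. Since arcs leave in
  pairs, the induction runs over proper subsets.\<close>

lemma all_bridges_count:
  assumes "finite V" "sym E" "E \<subseteq> V \<times> V" "all_bridges E"
  shows "card E + 2 * card (components V E) = 2 * card V"
proof -
  have "finite E"
    using assms finite_subset by blast
  then show ?thesis
    using assms(2-4)
  proof (induction E rule: finite_psubset_induct)
    case (psubset E)
    show ?case
    proof (cases "E = {}")
      case True
      then show ?thesis
        by (auto simp: components_def card_image inj_on_def)
    next
      case False
      then obtain a b where ab: "(a, b) \<in> E" by auto
      define E0 where "E0 = E - {(a, b), (b, a)}"
      have ba: "(b, a) \<in> E" using ab psubset.prems(1) by (meson symE)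
      have E: "E = insert (a, b) (insert (b, a) E0)"
        using ab ba by (auto simp: E0_def)
      have nr: "(a, b) \<notin> E0\<^sup>*"
        using psubset.prems(3) ab by (auto simp: all_bridges_def E0_def)
      \<comment> \<open>Reflexivity of \<open>E0\<^sup>*\<close> excludes a loop, so the two removed
        arcs are distinct.\<close>
      then have neq: "a \<noteq> b" by auto
      have symE0: "sym E0"
        using psubset.prems(1) by (auto simp: E0_def sym_def)
      have "E0 \<subset> E" using ab by (auto simp: E0_def)
      moreover from this have "all_bridges E0"
        using all_bridges_subset[OF psubset.prems(3)] by blast
      ultimately have IH: "card E0 + 2 * card (components V E0) = 2 * card V"
        using psubset.IH symE0 psubset.prems(2) by blast
      have "card (components V E0) = Suc (card (components V E))"
        unfolding E using components_insert_bridge[OF assms(1) symE0 _ _ nr] ab psubset.prems(2)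
        by blast
      moreover have "card E = card E0 + 2"
      proof -
        have "finite E0" "(a, b) \<notin> insert (b, a) E0" "(b, a) \<notin> E0"
          using psubset.hyps neq by (auto simp: E0_def)
        then show ?thesis by (simp add: E)
      qed
      ultimately show ?thesis using IH by simp
    qed
  qed
qed

text \<open>Double counting along the map from arcs to edges: each fibre consists of an arc and its
  reverse, which differ by irreflexivity.\<close>

lemma card_sym_irrefl:
  assumes "finite E" "sym E" "irrefl E"
  shows "card E = 2 * card ((\<lambda>(u, v). {u, v}) ` E)"
proof -
  let ?f = "\<lambda>(u, v). {u, v}"
  have two: "card {p \<in> E. ?f p = e} = 2" if e: "e \<in> ?f ` E" for e
  proof -
    obtain u v where uv: "(u, v) \<in> E" and e_eq: "e = {u, v}" using e by auto
    have vu: "(v, u) \<in> E" using uv assms(2) by (meson symE)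
    have "?f p = e \<longleftrightarrow> p = (u, v) \<or> p = (v, u)" for p
      unfolding e_eq by (cases p) (simp add: doubleton_eq_iff)
    then have "{p \<in> E. ?f p = e} = {p \<in> E. p = (u, v) \<or> p = (v, u)}"
      by (simp only:)
    also have "\<dots> = {(u, v), (v, u)}"
      using uv vu by blast
    finally have eq: "{p \<in> E. ?f p = e} = {(u, v), (v, u)}" .
    have "u \<noteq> v" using uv assms(3) by (metis irreflD)
    then show ?thesis unfolding eq by simp
  qed
  have "card E = (\<Sum>e \<in> ?f ` E. card {p \<in> E. ?f p = e})"
    using sum.image_gen[OF assms(1), of "\<lambda>_. 1 :: nat" ?f] unfolding card_eq_sum .
  also have "\<dots> = (\<Sum>e \<in> ?f ` E. 2)"
    by (rule sum.cong[OF refl two])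
  finally show ?thesis by (simp only: sum_constant mult.commute of_nat_id)
qed

lemma pcas_rtrancl:
  assumes "pcas u p v" "set p \<subseteq> E"
  shows "(u, v) \<in> E\<^sup>*"
  using assms by (induction u p v rule: pcas.induct) (auto intro: converse_rtrancl_into_rtrancl)

section \<open>Connectedness, cycles and trees in graphs\<close>

context pair_graph
begin

lemma sym_parcs: "sym (parcs G)"
  using arcs_symmetric by (auto intro: symI)

text \<open>\<open>connected\<close> means strong connectedness of the symmetric closure, which has
  the same reachability as a symmetric digraph itself. The closure form opens the way to the results
  on relations.\<close>

lemma connected_iff_rtrancl:
  "Digraph_Component.connected (with_proj G) \<longleftrightarrow>
    pverts G \<noteq> {} \<and> pverts G \<times> pverts G \<subseteq> (parcs G)\<^sup>*"
  unfolding connected_def strongly_connected_def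
  using reachable_mk_symmetric_eq[OF sym_arcs] reachable_conv' by auto

lemma components_connected:
  assumes "Digraph_Component.connected (with_proj G)"
  shows "card (components (pverts G) (parcs G)) = 1"
proof -
  have "(parcs G)\<^sup>* `` {v} = pverts G" if "v \<in> pverts G" for v
  proof -
    have "w \<in> pverts G" if "(v, w) \<in> (parcs G)\<^sup>*" for w
      using that \<open>v \<in> pverts G\<close> by (induction rule: rtrancl_induct) (auto dest: in_arcsD2)
    then show ?thesis
      using assms that unfolding connected_iff_rtrancl by blast
  qed
  then have "components (pverts G) (parcs G) = {pverts G}"
    using assms unfolding components_def connected_iff_rtrancl by auto
  then show ?thesis by simp
qed

lemma card_parcs: "card (parcs G) = 2 * card (uedges G)"
proof -
  have "irrefl (parcs G)"
    using pair_no_loops by (fastforce simp: irrefl_def)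
  then show ?thesis
    unfolding uedges_def using card_sym_irrefl pair_finite_arcs sym_parcs by blast
qed

text \<open>If the ends of an edge stay joined after its deletion, a path between them closes up to
  a cycle with the arc back from \<open>v\<close> to \<open>u\<close>.\<close>

lemma all_bridges_if_no_cycle:
  assumes "\<nexists>p. undirected_cycle G p"
  shows "all_bridges (parcs G)"
  unfolding all_bridges_def
proof (safe)
  fix u v assume uv: "(u, v) \<in> parcs G"
    and reach: "(u, v) \<in> (parcs G - {(u, v), (v, u)})\<^sup>*"
  \<comment> \<open>Working in the graph without the edge turns mere reachability into a path with
    distinct vertices that avoids both arcs.\<close>
  define H where "H = \<lparr>pverts = pverts G, parcs = parcs G - {(u, v), (v, u)}\<rparr>"
  interpret H: pair_wf_digraph H
    by unfold_locales (auto simp: H_def dest: arc_fst_in_verts arc_snd_in_verts)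
  have "u \<in> pverts H" using uv by (auto simp: H_def dest: in_arcsD1)
  then obtain p where p: "H.apath u p v"
    using reach H.reachable_conv'[of u v] H.reachable_apath by (auto simp: H_def)
  then have "set p \<subseteq> parcs H" and cas: "pcas u p v" and dist: "distinct (pawalk_verts u p)"
    by (auto simp: H.apath_def H.awalk_def)
  then have arcs: "set p \<subseteq> parcs G - {(u, v), (v, u)}"
    by (simp add: H_def)
  have "u \<noteq> v" using uv pair_no_loops by fastforce
  \<comment> \<open>An empty path would give \<open>u = v\<close>, and a single arc would be the
    deleted one; with the closing arc the length reaches three.\<close>
  then have "2 \<le> length p"
    using cas arcs by (cases p; cases "tl p") auto
  moreover have "(v, u) \<in> parcs G" using uv arcs_symmetric by blast
  then have "awalk v ((v, u) # p) v"
    using cas arcs by (auto simp: awalk_def dest: in_arcsD1)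
  then have "cycle ((v, u) # p)"
    using dist by (auto simp: cycle_def)
  ultimately show False
    using assms by (force simp: undirected_cycle_def)
qed

text \<open>The rest \<open>q\<close> of a cycle bypasses its first arc \<open>(a, y)\<close>, so
  that edge is not a bridge. It remains to see that \<open>q\<close> uses neither
  \<open>(a, y)\<close> nor its reverse.\<close>

lemma no_cycle_if_all_bridges:
  assumes "all_bridges (parcs G)"
  shows "\<not> undirected_cycle G p"
proof
  assume "undirected_cycle G p"
  then obtain a where a: "awalk a p a" "distinct (tl (pawalk_verts a p))" and len: "3 \<le> length p"
    by (auto simp: undirected_cycle_def cycle_def)
  obtain x y e f r where p: "p = (x, y) # e # f # r"
    using len by (cases p; cases "tl p"; cases "tl (tl p)") auto
  define q where "q = e # f # r"
  have x: "x = a" and ay: "(a, y) \<in> parcs G" and q: "apath y q a"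
    using a p by (auto simp: awalk_Cons_iff apath_def q_def)
  \<comment> \<open>The path \<open>q\<close> meets \<open>a\<close> only at its end, so no arc of
    \<open>q\<close> leaves \<open>a\<close>.\<close>
  have fst_notin: "a \<notin> fst ` set q"
  proof -
    have "pawalk_verts y q = map fst q @ [snd (last q)]"
      by (simp add: awalk_verts_conv q_def)
    moreover have "last (pawalk_verts y q) = a" "distinct (pawalk_verts y q)"
      using q by (auto simp: apath_def)
    ultimately show ?thesis by auto
  qed
  \<comment> \<open>Only the first arc \<open>e\<close> of \<open>q\<close> leaves \<open>y\<close>,
    and it cannot end in \<open>a\<close> because the nonempty path \<open>f # r\<close> still leads
    from its head to \<open>a\<close>. This is where length at least three enters.\<close>
  have tail: "fst e = y" "apath (snd e) (f # r) a" "y \<notin> fst ` set (f # r)"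
    using q by (simp_all add: q_def apath_Cons_iff[of y e] awalk_verts_conv) auto
  then have "snd e \<noteq> a" using apath_nonempty_ends by blast
  then have "(y, a) \<notin> set q"
    using tail unfolding q_def by (metis fst_conv image_eqI set_ConsD snd_conv)
  moreover have "(a, y) \<notin> set q" using fst_notin by force
  ultimately have "set q \<subseteq> parcs G - {(y, a), (a, y)}"
    using q by (auto simp: apath_def awalk_def)
  moreover have "pcas y q a" using q by (auto simp: apath_def awalk_def)
  ultimately have "(y, a) \<in> (parcs G - {(y, a), (a, y)})\<^sup>*"
    by (rule pcas_rtrancl[rotated])
  moreover have "(y, a) \<in> parcs G" using ay arcs_symmetric by blast
  ultimately show False using assms unfolding all_bridges_def by blast
qed

lemma card_uedges_undirected_tree:
  assumes "undirected_tree G"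
  shows "card (uedges G) + 1 = card (pverts G)"
proof -
  have conn: "Digraph_Component.connected (with_proj G)" and "all_bridges (parcs G)"
    using assms all_bridges_if_no_cycle by (auto simp: undirected_tree_def)
  then have "card (parcs G) + 2 * card (components (pverts G) (parcs G)) = 2 * card (pverts G)"
    using all_bridges_count[OF pair_finite_verts sym_parcs] arc_fst_in_verts arc_snd_in_verts
    by fastforce
  then show ?thesis
    using components_connected[OF conn] card_parcs by simp
qed

section \<open>Edge deletion, spanning trees and the cyclomatic number\<close>

lemma pair_graph_del_uedges: "pair_graph (del_uedges G F)"
proof (unfold_locales)
  show "finite (pverts (del_uedges G F))" by (simp add: del_uedges_def pair_finite_verts)
  show "finite (parcs (del_uedges G F))"
    by (rule finite_subset[OF _ pair_finite_arcs]) (auto simp: del_uedges_def)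
  show "symmetric (with_proj (del_uedges G F))"
    unfolding symmetric_def
    by (auto simp: del_uedges_def insert_commute arcs_symmetric intro!: symI)
qed (auto simp: del_uedges_def dest: arc_fst_in_verts arc_snd_in_verts pair_no_loops)

lemma uedges_del_uedges: "uedges (del_uedges G F) = uedges G - F"
  by (auto simp: uedges_def del_uedges_def)

lemma finite_uedges: "finite (uedges G)"
  by (simp add: uedges_def pair_finite_arcs)

text \<open>Provides the witness without which the \<open>LEAST\<close> in
  \<open>cyclomatic_number\<close> would be unspecified.\<close>

lemma exists_spanning_tree:
  assumes "Digraph_Component.connected (with_proj G)"
  shows "\<exists>F \<subseteq> uedges G. undirected_tree (del_uedges G F)"
proof -
  let ?P = "\<lambda>F. F \<subseteq> uedges G \<and> Digraph_Component.connected (with_proj (del_uedges G F))"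
  have "del_uedges G {} = G" by (simp add: del_uedges_def)
  then have "?P {}" using assms by simp
  \<comment> \<open>\<open>ex_has_greatest_nat\<close> asks for a strict bound, hence the
    \<open>Suc\<close>.\<close>
  moreover have "\<forall>F. ?P F \<longrightarrow> card F < Suc (card (uedges G))"
    using card_mono[OF finite_uedges] by (simp add: less_Suc_eq_le)
  ultimately have "\<exists>F. ?P F \<and> (\<forall>F'. ?P F' \<longrightarrow> card F' \<le> card F)"
    by (rule ex_has_greatest_nat[where P = ?P])
  then obtain F where F: "?P F" and max: "\<And>F'. ?P F' \<Longrightarrow> card F' \<le> card F"
    by (elim exE conjE) simp
  interpret T: pair_graph "del_uedges G F" by (rule pair_graph_del_uedges)
  let ?E = "parcs (del_uedges G F)"
  have "all_bridges ?E"
    unfolding all_bridges_def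
  proof safe
    fix u v assume uv: "(u, v) \<in> ?E" and reach: "(u, v) \<in> (?E - {(u, v), (v, u)})\<^sup>*"
    interpret H: pair_graph "del_uedges G (insert {u, v} F)" by (rule pair_graph_del_uedges)
    have H: "parcs (del_uedges G (insert {u, v} F)) = ?E - {(u, v), (v, u)}"
      unfolding del_uedges_def
      by (simp only: pair_pre_digraph.simps insert_iff doubleton_eq_iff) auto
    have "sym (?E - {(u, v), (v, u)})"
      using H.sym_parcs H by simp
    then have "(v, u) \<in> (?E - {(u, v), (v, u)})\<^sup>*"
      using reach by (meson symE sym_rtrancl)
    \<comment> \<open>Each deleted arc is replaced by a detour, so the closure does not shrink and
      the graph stays connected, against the maximality of \<open>F\<close>.\<close>
    then have "?E \<subseteq> (?E - {(u, v), (v, u)})\<^sup>*"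
      using reach by auto
    then have "?E\<^sup>* \<subseteq> (?E - {(u, v), (v, u)})\<^sup>*"
      by (rule rtrancl_subset_rtrancl)
    then have "Digraph_Component.connected (with_proj (del_uedges G (insert {u, v} F)))"
      using F unfolding H.connected_iff_rtrancl T.connected_iff_rtrancl H
      by (auto simp: del_uedges_def)
    moreover have e: "{u, v} \<in> uedges G" "{u, v} \<notin> F"
      using uv by (auto simp: del_uedges_def uedges_def)
    ultimately have "card (insert {u, v} F) \<le> card F"
      using max F by blast
    moreover have "finite F" using F finite_uedges finite_subset by blast
    ultimately show False using e by simp
  qed
  then show ?thesis
    using F T.no_cycle_if_all_bridges T.pair_graph by (auto simp: undirected_tree_def)
qed

text \<open>All edge sets whose deletion leaves a tree have the same size, as the number of vertices
  fixes the number of edges of a tree; the minimum is this common size. The additive form avoids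
  truncated subtraction.\<close>

lemma cyclomatic_number_eq:
  assumes "Digraph_Component.connected (with_proj G)"
  shows "cyclomatic_number G + card (pverts G) = card (uedges G) + 1"
proof -
  have count: "card F + card (pverts G) = card (uedges G) + 1"
    if F: "F \<subseteq> uedges G" "undirected_tree (del_uedges G F)" for F
  proof -
    have "card (uedges G - F) + 1 = card (pverts G)"
      using pair_graph.card_uedges_undirected_tree[OF pair_graph_del_uedges F(2)]
      by (simp add: uedges_del_uedges) (simp add: del_uedges_def)
    moreover have "card (uedges G - F) + card F = card (uedges G)"
      using F(1) finite_uedges by (metis card_Diff_subset card_mono finite_subset le_add_diff_inverse2)
    ultimately show ?thesis by simp
  qed
  have "\<exists>k. \<exists>F \<subseteq> uedges G. card F = k \<and> undirected_tree (del_uedges G F)"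
    using exists_spanning_tree[OF assms] by blast
  then have "\<exists>F \<subseteq> uedges G. card F = cyclomatic_number G \<and> undirected_tree (del_uedges G F)"
    unfolding cyclomatic_number_def by (rule LeastI_ex)
  then show ?thesis using count by metis
qed

text \<open>Arcs are grouped by their tails. Each edge contributes one arc at either end, so this is
  the handshake count.\<close>

lemma card_parcs_regular:
  assumes "regular_graph d G"
  shows "card (parcs G) = card (pverts G) * d"
proof -
  have "card (parcs G) = (\<Sum>v \<in> pverts G. card {e \<in> parcs G. fst e = v})"
    using sum.group[OF pair_finite_arcs pair_finite_verts, of fst "\<lambda>_. 1 :: nat"]
      arc_fst_in_verts by (simp add: image_subset_iff)
  also have "\<dots> = (\<Sum>v \<in> pverts G. d)"
    using assms by (intro sum.cong) (auto simp: regular_graph_def out_degree_def out_arcs_def)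
  finally show ?thesis by simp
qed

end

theorem theorem5p2:
  fixes G :: "'a pair_pre_digraph" and n d :: nat
  assumes "pair_graph G"
    and "Digraph_Component.connected (with_proj G)"
    and "regular_graph d G"
    and "bipartite_graph G"
    and "card (pverts G) = n"
  shows "real (cyclomatic_number G) = real n / 2 * (real d - 2) + 1"
proof -
  interpret pair_graph G by fact
  have "real (cyclomatic_number G) + real n = real (card (uedges G)) + 1"
    using cyclomatic_number_eq[OF assms(2)] assms(5) by linarith
  \<comment> \<open>Both sides count the arcs: two for each edge, and \<open>d\<close> leaving each
    vertex.\<close>
  moreover have "2 * real (card (uedges G)) = real n * real d"
    using card_parcs card_parcs_regular[OF assms(3)] assms(5)
    by (metis of_nat_mult of_nat_numeral)
  ultimately show ?thesis
    by (simp add: field_simps)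
qed

end
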